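(* Let $b$ and $c$ be positive integers, let $p$ be a prime number, and let $K$ be an infinite field with $\operatorname{char}(K)=p$. Then the number $\binom{b+c}{b}$ of integer partitions contained inside a $b\times c$ rectangle is divisible by $p$ if and only if the algebra $K[x,y,z]/(x^{b+1},y^{c+1},z^{b+c})$ fails to have the Weak Lefschetz Property.
   Context: An integer partition contained inside a $b\times c$ rectangle is a partition with at most $b$ parts, each at most $c$ (the empty partition included); there are $\binom{b+c}{b}$ of them. A standard graded artinian $K$-algebra $A=\bigoplus_d A_d$ has the Weak Lefschetz Property if there is a linear form $L$ such that, for all $i$, the multiplication map $\times L:A_i\to A_{i+1}$ has maximal rank (i.e. is injective or surjective). *)

theory Defs
  imports
    "HOL-Library.Poly_Mapping"
    "HOL-Library.Multiset"
    "HOL-Algebra.Algebraic_Closure_Type"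
begin

section \<open>Integer partitions in a rectangle\<close>

text \<open>A partition is the multiset of its (positive) parts; the size of the multiset is
  the number of parts.\<close>

definition partitions_in_rectangle :: "nat \<Rightarrow> nat \<Rightarrow> nat multiset set" where
  "partitions_in_rectangle b c =
     {P. 0 \<notin># P \<and> size P \<le> b \<and> (\<forall>k \<in># P. k \<le> c)}"

section \<open>The Weak Lefschetz Property\<close>

text \<open>The graded algebra is a ring \<open>A\<close> together with its family of graded components \<open>G\<close>.
  Having maximal rank does not depend on the scalars, so the \<open>K\<close>-action is not part of
  the data.\<close>

definition weak_lefschetz :: "('a, 'm) ring_scheme \<Rightarrow> (nat \<Rightarrow> 'a set) \<Rightarrow> bool" where
  "weak_lefschetz A G \<longleftrightarrow>
     (\<exists>L \<in> G 1. \<forall>i.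
        inj_on (\<lambda>a. L \<otimes>\<^bsub>A\<^esub> a) (G i) \<or> (\<lambda>a. L \<otimes>\<^bsub>A\<^esub> a) ` G i = G (Suc i))"

section \<open>Polynomials and graded quotients\<close>

text \<open>Monomials are finitely supported exponent functions, and polynomials are finitely
  supported functions from monomials to coefficients, with the convolution product.\<close>

type_synonym ('v, 'k) mpoly = "('v \<Rightarrow>\<^sub>0 nat) \<Rightarrow>\<^sub>0 'k"

definition mvar :: "'v \<Rightarrow> ('v, 'k :: comm_ring_1) mpoly" where
  "mvar v = Poly_Mapping.single (Poly_Mapping.single v 1) 1"

definition mdegree :: "('v \<Rightarrow>\<^sub>0 nat) \<Rightarrow> nat" where
  "mdegree m = (\<Sum>v \<in> Poly_Mapping.keys m. Poly_Mapping.lookup m v)"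

text \<open>Includes the zero polynomial, for every \<open>d\<close>.\<close>

definition forms :: "nat \<Rightarrow> ('v, 'k :: comm_ring_1) mpoly set" where
  "forms d = {f. \<forall>m \<in> Poly_Mapping.keys f. mdegree m = d}"

text \<open>The grading that \<open>K[\<dots>]/I\<close> inherits from the standard grading, for a homogeneous
  ideal \<open>I\<close>.\<close>

definition quot_grading ::
  "('v, 'k :: comm_ring_1) mpoly set \<Rightarrow> nat \<Rightarrow> ('v, 'k) mpoly set set" where
  "quot_grading I d = (\<lambda>f. I +>\<^bsub>ring_of_type_algebra\<^esub> f) ` forms d"

datatype xyz = Var_x | Var_y | Var_z

definition monomial_ci_ideal ::
  "nat \<Rightarrow> nat \<Rightarrow> nat \<Rightarrow> (xyz, 'k :: comm_ring_1) mpoly set" where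
  "monomial_ci_ideal l m n =
     Idl\<^bsub>ring_of_type_algebra\<^esub> {mvar Var_x ^ l, mvar Var_y ^ m, mvar Var_z ^ n}"

definition monomial_ci ::
  "'k itself \<Rightarrow> nat \<Rightarrow> nat \<Rightarrow> nat \<Rightarrow> (xyz, 'k :: comm_ring_1) mpoly set ring" where
  "monomial_ci K l m n = ring_of_type_algebra Quot monomial_ci_ideal l m n"

definition monomial_ci_grading ::
  "'k itself \<Rightarrow> nat \<Rightarrow> nat \<Rightarrow> nat \<Rightarrow> nat \<Rightarrow> (xyz, 'k :: comm_ring_1) mpoly set set" where
  "monomial_ci_grading K l m n = quot_grading (monomial_ci_ideal l m n)"

end

theory Submission
  imports Defs
begin

text \<open>
  Let \<open>A = K[x,y,z]/(x\<^sup>b\<^sup>+\<^sup>1, y\<^sup>c\<^sup>+\<^sup>1, z\<^sup>b\<^sup>+\<^sup>c)\<close>. For \<open>L = \<alpha> x + \<beta> y + \<gamma> z\<close> with \<open>\<gamma> \<noteq> 0\<close>, eliminating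
  \<open>z\<close> gives \<open>A/(L) = K[x,y]/(x\<^sup>b\<^sup>+\<^sup>1, y\<^sup>c\<^sup>+\<^sup>1, (\<alpha> x + \<beta> y)\<^sup>b\<^sup>+\<^sup>c)\<close>. In degree \<open>b + c\<close> the ring
  \<open>K[x,y]/(x\<^sup>b\<^sup>+\<^sup>1, y\<^sup>c\<^sup>+\<^sup>1)\<close> is spanned by \<open>x\<^sup>b y\<^sup>c\<close>, and \<open>(\<alpha> x + \<beta> y)\<^sup>b\<^sup>+\<^sup>c\<close> equals \<open>\<alpha>\<^sup>b \<beta>\<^sup>c x\<^sup>b y\<^sup>c\<close> times the
  number of partitions in the rectangle (\<open>power_of_linear_form_in_x_y\<close>). So multiplication by
  \<open>L\<close> can be onto in degree \<open>b + c\<close> only if this number is nonzero in \<open>K\<close>, and for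
  \<open>L = x + y + z\<close> this is also sufficient, in all degrees from \<open>b + c\<close> on
  (\<open>sum_of_variables_surjective\<close>).

  The rest is duality. The algebra \<open>A\<close> has a one-dimensional socle, in the odd degree
  \<open>2 (b + c) - 1\<close>, and pairs complementary degrees perfectly into it. A form
  annihilated by \<open>L\<close> therefore obstructs surjectivity in the complementary degree
  (\<open>annihilated_form_obstructs_surjectivity\<close>). If the binomial coefficient is nonzero,
  this gives injectivity of \<open>x + y + z\<close> in all degrees below \<open>b + c - 1\<close>, hence maximal rank everywhere.
  If it is zero, every linear form annihilates some explicit nonzero form of degree
  \<open>b + c - 1\<close> (\<open>geometric_sum_annihilated\<close> and \<open>binary_linear_form_annihilated\<close>),
  and since that degree and \<open>b + c\<close> are complementary, multiplication from the one to
  the other is neither injective nor surjective.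
\<close>

section \<open>Counting partitions in a rectangle\<close>

text \<open>Removing one part equal to \<open>c\<close>, if there is one, splits the partitions in a
  \<open>b \<times> c\<close> rectangle into those in a \<open>b \<times> (c - 1)\<close> and those in a \<open>(b - 1) \<times> c\<close>
  rectangle, which is Pascal's recursion. Finiteness is carried along because the cardinality of
  the disjoint union needs it.\<close>
lemma card_partitions_in_rectangle:
  "finite (partitions_in_rectangle b c) \<and>
   card (partitions_in_rectangle b c) = (b + c) choose b"
proof (induction "b + c" arbitrary: b c)
  case 0
  then have "partitions_in_rectangle b c = {{#}}"
    by (auto simp: partitions_in_rectangle_def)
  with 0 show ?case by simp
next
  case (Suc n)
  consider "b = 0" | "c = 0" | b' c' where "b = Suc b'" "c = Suc c'"
    by (metis not0_implies_Suc)
  then show ?case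
  proof cases
    assume "b = 0"
    then have "partitions_in_rectangle b c = {{#}}"
      by (auto simp: partitions_in_rectangle_def)
    with \<open>b = 0\<close> show ?thesis by simp
  next
    assume "c = 0"
    have "P = {#}" if "P \<in> partitions_in_rectangle b c" for P
      using that \<open>c = 0\<close> by (cases P) (auto simp: partitions_in_rectangle_def)
    then have "partitions_in_rectangle b c = {{#}}"
      by (auto simp: partitions_in_rectangle_def)
    with \<open>c = 0\<close> show ?thesis by simp
  next
    fix b' c' assume b: "b = Suc b'" and c: "c = Suc c'"
    have split: "partitions_in_rectangle b c =
        partitions_in_rectangle b c' \<union> add_mset c ` partitions_in_rectangle b' c"
      (is "_ = ?A \<union> ?B")
    proof (intro equalityI subsetI)
      fix P assume P: "P \<in> partitions_in_rectangle b c"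
      show "P \<in> ?A \<union> ?B"
      proof (cases "c \<in># P")
        case True
        then obtain Q where "P = add_mset c Q"
          by (auto dest: multi_member_split)
        with P show ?thesis
          by (auto simp: partitions_in_rectangle_def b)
      next
        case False
        with P have "\<forall>k\<in>#P. k \<le> c'"
          using c le_Suc_eq by (auto simp: partitions_in_rectangle_def)
        with P show ?thesis
          by (auto simp: partitions_in_rectangle_def)
      qed
    qed (auto simp: partitions_in_rectangle_def b c)
    have disj: "?A \<inter> ?B = {}"
      by (auto simp: partitions_in_rectangle_def c)
    have A: "finite ?A \<and> card ?A = (b + c') choose b"
      using Suc.hyps(1)[of b c'] Suc.hyps(2) c by auto
    have B: "finite (partitions_in_rectangle b' c) \<and>
        card (partitions_in_rectangle b' c) = (b' + c) choose b'"
      using Suc.hyps(1)[of b' c] Suc.hyps(2) b by simp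
    have "card ?B = (b' + c) choose b'"
      using B by (simp add: card_image inj_on_def)
    then have "card (partitions_in_rectangle b c) = ((b + c') choose b) + ((b' + c) choose b')"
      unfolding split using A B disj by (subst card_Un_disjoint) auto
    then show ?thesis
      using A B unfolding split by (simp add: b c)
  qed
qed

section \<open>The Weak Lefschetz Property of a graded quotient\<close>

lemma ring_of_type_algebra_simps:
  "carrier (ring_of_type_algebra :: 'a :: comm_ring_1 ring) = UNIV"
  "f \<oplus>\<^bsub>ring_of_type_algebra\<^esub> g = (f + g :: 'a)"
  "f \<otimes>\<^bsub>ring_of_type_algebra\<^esub> g = f * g"
  "\<zero>\<^bsub>ring_of_type_algebra\<^esub> = (0 :: 'a)"
  "\<one>\<^bsub>ring_of_type_algebra\<^esub> = (1 :: 'a)"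
  by (simp_all add: ring_of_type_algebra_def)

lemma minus_ring_of_type_algebra:
  "\<ominus>\<^bsub>ring_of_type_algebra\<^esub> f = - (f :: 'a :: comm_ring_1)"
proof -
  interpret ring "ring_of_type_algebra :: 'a ring" by (rule ring_from_type_algebra)
  show ?thesis
    by (rule minus_equality) (simp_all add: ring_of_type_algebra_simps)
qed

lemma ideal_ring_of_type_algebra_iff:
  fixes I :: "'a :: comm_ring_1 set"
  shows "ideal I ring_of_type_algebra \<longleftrightarrow>
     0 \<in> I \<and> (\<forall>f\<in>I. \<forall>g\<in>I. f + g \<in> I) \<and> (\<forall>f. \<forall>g\<in>I. f * g \<in> I)"
    (is "_ \<longleftrightarrow> ?rhs")
proof
  assume "ideal I ring_of_type_algebra"
  then interpret ideal I ring_of_type_algebra .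
  show ?rhs
    using additive_subgroup.a_closed[OF additive_subgroup_axioms]
      additive_subgroup.zero_closed[OF additive_subgroup_axioms] I_l_closed
    by (auto simp: ring_of_type_algebra_simps)
next
  assume rhs: ?rhs
  then have "- f \<in> I" if "f \<in> I" for f
    using that by (metis mult_minus1)
  then have inv: "inv\<^bsub>add_monoid ring_of_type_algebra\<^esub> f \<in> I" if "f \<in> I" for f
    using that by (simp only: minus_ring_of_type_algebra flip: a_inv_def)
  have "subgroup I (add_monoid ring_of_type_algebra)"
    by (rule subgroup.intro[OF _ _ _ inv]) (use rhs in \<open>auto simp: ring_of_type_algebra_simps\<close>)
  moreover from rhs have "g * f \<in> I" if "g \<in> I" for f g
    using that by (simp add: mult.commute[of g])
  ultimately show "ideal I ring_of_type_algebra"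
    using rhs
    by (intro idealI ring_from_type_algebra) (simp_all add: ring_of_type_algebra_simps)
qed

lemma coset_eq_iff:
  fixes I :: "'a :: comm_ring_1 set"
  assumes "ideal I ring_of_type_algebra"
  shows "I +>\<^bsub>ring_of_type_algebra\<^esub> f = I +>\<^bsub>ring_of_type_algebra\<^esub> g \<longleftrightarrow> f - g \<in> I"
proof -
  interpret ring "ring_of_type_algebra :: 'a ring" by (rule ring_from_type_algebra)
  show ?thesis
    using quotient_eq_iff_same_a_r_cos[OF assms, of f g]
    by (simp add: ring_of_type_algebra_simps minus_ring_of_type_algebra a_minus_def)
qed

lemma mult_quotient_coset:
  fixes I :: "'a :: comm_ring_1 set"
  assumes "ideal I ring_of_type_algebra"
  shows "(I +>\<^bsub>ring_of_type_algebra\<^esub> f) \<otimes>\<^bsub>ring_of_type_algebra Quot I\<^esub> (I +>\<^bsub>ring_of_type_algebra\<^esub> g)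
    = I +>\<^bsub>ring_of_type_algebra\<^esub> (f * g)"
  using ideal.rcoset_mult_add[OF assms, of f g]
  by (simp add: FactRing_def ring_of_type_algebra_simps)

lemma poly_mapping_eq_sum_single:
  "f = (\<Sum>k\<in>Poly_Mapping.keys f. Poly_Mapping.single k (Poly_Mapping.lookup f k))"
  by (rule poly_mapping_eqI)
    (auto simp: lookup_sum lookup_single when_def in_keys_iff)

text \<open>Only one product of monomials can contribute here, because exponents cancel.\<close>
lemma lookup_times_single:
  fixes f :: "'m :: cancel_comm_monoid_add \<Rightarrow>\<^sub>0 'k :: comm_ring_1"
  shows "Poly_Mapping.lookup (f * Poly_Mapping.single m a) (k + m) = Poly_Mapping.lookup f k * a"
proof -
  have "f * Poly_Mapping.single m a =
      (\<Sum>k\<in>Poly_Mapping.keys f. Poly_Mapping.single (k + m) (Poly_Mapping.lookup f k * a))"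
    by (subst poly_mapping_eq_sum_single[of f]) (simp only: sum_distrib_right mult_single)
  then show ?thesis
    by (auto simp: lookup_sum lookup_single when_def in_keys_iff)
qed

lemma mdegree_add: "mdegree (m + k) = mdegree m + mdegree k"
proof -
  let ?S = "Poly_Mapping.keys m \<union> Poly_Mapping.keys k"
  have *: "mdegree q = (\<Sum>v\<in>?S. Poly_Mapping.lookup q v)" if "Poly_Mapping.keys q \<subseteq> ?S" for q
    unfolding mdegree_def
    by (rule sum.mono_neutral_left) (use that in \<open>auto simp: in_keys_iff\<close>)
  show ?thesis
    using keys_add[of m k] by (simp add: * lookup_add sum.distrib)
qed

lemma forms_add: "f \<in> forms d \<Longrightarrow> g \<in> forms d \<Longrightarrow> f + g \<in> forms d"
  using keys_add[of f g] by (auto simp: forms_def)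

lemma forms_diff: "f \<in> forms d \<Longrightarrow> g \<in> forms d \<Longrightarrow> f - g \<in> forms d"
  by (auto simp: forms_def in_keys_iff lookup_minus)

lemma forms_uminus: "f \<in> forms d \<Longrightarrow> - f \<in> forms d"
  by (auto simp: forms_def)

lemma zero_in_forms: "0 \<in> forms d"
  by (simp add: forms_def)

lemma forms_sum: "(\<And>i. i \<in> S \<Longrightarrow> f i \<in> forms d) \<Longrightarrow> sum f S \<in> forms d"
  by (induction S rule: infinite_finite_induct) (auto intro: forms_add zero_in_forms)

lemma forms_mult: "f \<in> forms d \<Longrightarrow> g \<in> forms e \<Longrightarrow> f * g \<in> forms (d + e)"
  using keys_mult[of f g] by (fastforce simp: forms_def mdegree_add)

lemma forms_power: "f \<in> forms d \<Longrightarrow> f ^ n \<in> forms (n * d)"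
  by (induction n) (auto intro: forms_mult simp: forms_def[of 0] mdegree_def)

lemma single_in_forms: "mdegree m = d \<Longrightarrow> Poly_Mapping.single m a \<in> forms d"
  by (simp add: forms_def)

text \<open>With this criterion the coset ring disappears from the argument: injectivity becomes
  triviality of the kernel, because the forms of a fixed degree are closed under subtraction, and
  surjectivity becomes solvability modulo \<open>I\<close>, because multiplication by \<open>L\<close> always lands in
  the next degree.\<close>
lemma weak_lefschetz_quotient_iff:
  fixes I :: "('v, 'k :: comm_ring_1) mpoly set"
  assumes I: "ideal I ring_of_type_algebra"
  shows "weak_lefschetz (ring_of_type_algebra Quot I) (quot_grading I) \<longleftrightarrow>
    (\<exists>L\<in>forms 1. \<forall>i. (\<forall>f\<in>forms i. L * f \<in> I \<longrightarrow> f \<in> I) \<or>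
                      (\<forall>g\<in>forms (Suc i). \<exists>f\<in>forms i. g - L * f \<in> I))"
proof -
  let ?q = "\<lambda>f. I +>\<^bsub>ring_of_type_algebra\<^esub> f"
  have inj: "inj_on (\<lambda>a. ?q L \<otimes>\<^bsub>ring_of_type_algebra Quot I\<^esub> a) (quot_grading I i)
      \<longleftrightarrow> (\<forall>f\<in>forms i. L * f \<in> I \<longrightarrow> f \<in> I)" (is "?l \<longleftrightarrow> ?r") for L i
  proof
    assume ?l
    then have "\<forall>f\<in>forms i. \<forall>g\<in>forms i. L * f - L * g \<in> I \<longrightarrow> f - g \<in> I"
      by (simp add: inj_on_def quot_grading_def mult_quotient_coset[OF I] coset_eq_iff[OF I])
    moreover have "0 \<in> forms i" by (simp add: forms_def)
    ultimately show ?r by fastforce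
  next
    assume ?r
    then have "\<forall>f\<in>forms i. \<forall>g\<in>forms i. L * f - L * g \<in> I \<longrightarrow> f - g \<in> I"
      by (metis forms_diff right_diff_distrib)
    then show ?l
      by (simp add: inj_on_def quot_grading_def mult_quotient_coset[OF I] coset_eq_iff[OF I])
  qed
  have surj: "(\<lambda>a. ?q L \<otimes>\<^bsub>ring_of_type_algebra Quot I\<^esub> a) ` quot_grading I i = quot_grading I (Suc i)
      \<longleftrightarrow> (\<forall>g\<in>forms (Suc i). \<exists>f\<in>forms i. g - L * f \<in> I)" if "L \<in> forms 1" for L i
  proof -
    have "L * f \<in> forms (Suc i)" if "f \<in> forms i" for f
      using forms_mult[OF \<open>L \<in> forms 1\<close> that] by simp
    then have "(\<lambda>a. ?q L \<otimes>\<^bsub>ring_of_type_algebra Quot I\<^esub> a) ` quot_grading I i \<subseteq> quot_grading I (Suc i)"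
      by (auto simp: quot_grading_def mult_quotient_coset[OF I])
    then have "(\<lambda>a. ?q L \<otimes>\<^bsub>ring_of_type_algebra Quot I\<^esub> a) ` quot_grading I i = quot_grading I (Suc i)
      \<longleftrightarrow> quot_grading I (Suc i) \<subseteq> (\<lambda>a. ?q L \<otimes>\<^bsub>ring_of_type_algebra Quot I\<^esub> a) ` quot_grading I i"
      by blast
    also have "\<dots> \<longleftrightarrow> (\<forall>g\<in>forms (Suc i). \<exists>f\<in>forms i. ?q g = ?q (L * f))"
      by (auto simp: quot_grading_def subset_iff image_image image_iff mult_quotient_coset[OF I])
    finally show ?thesis by (simp add: coset_eq_iff[OF I])
  qed
  have "weak_lefschetz (ring_of_type_algebra Quot I) (quot_grading I) \<longleftrightarrow>
      (\<exists>L\<in>forms 1. \<forall>i.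
        inj_on (\<lambda>a. ?q L \<otimes>\<^bsub>ring_of_type_algebra Quot I\<^esub> a) (quot_grading I i) \<or>
        (\<lambda>a. ?q L \<otimes>\<^bsub>ring_of_type_algebra Quot I\<^esub> a) ` quot_grading I i = quot_grading I (Suc i))"
    unfolding weak_lefschetz_def by (subst (1) quot_grading_def) (rule bex_simps(7))
  then show ?thesis
    by (simp add: inj surj del: One_nat_def cong: bex_cong)
qed

section \<open>The monomial complete intersection in three variables\<close>

lemma ideal_closed:
  fixes I :: "'a :: comm_ring_1 set"
  assumes "ideal I ring_of_type_algebra"
  shows ideal_zero: "0 \<in> I"
    and ideal_add: "f \<in> I \<Longrightarrow> g \<in> I \<Longrightarrow> f + g \<in> I"
    and ideal_mult_left: "g \<in> I \<Longrightarrow> h * g \<in> I"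
    and ideal_mult_right: "g \<in> I \<Longrightarrow> g * h \<in> I"
    and ideal_diff: "f \<in> I \<Longrightarrow> g \<in> I \<Longrightarrow> f - g \<in> I"
proof -
  note I = assms[unfolded ideal_ring_of_type_algebra_iff]
  show "0 \<in> I" "f \<in> I \<Longrightarrow> g \<in> I \<Longrightarrow> f + g \<in> I" "g \<in> I \<Longrightarrow> h * g \<in> I"
    using I by blast+
  show "g \<in> I \<Longrightarrow> g * h \<in> I" for g
    using I by (metis mult.commute)
  show "f \<in> I \<Longrightarrow> g \<in> I \<Longrightarrow> f - g \<in> I"
    using I by (metis add_uminus_conv_diff mult_minus1)
qed

lemma ideal_sum:
  fixes I :: "'a :: comm_ring_1 set"
  assumes "ideal I ring_of_type_algebra" "\<And>i. i \<in> S \<Longrightarrow> f i \<in> I"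
  shows "sum f S \<in> I"
  using assms(2)
  by (induction S rule: infinite_finite_induct)
    (auto intro: ideal_zero[OF assms(1)] ideal_add[OF assms(1)])

lemma ideal_power_le:
  fixes I :: "'a :: comm_ring_1 set"
  assumes "ideal I ring_of_type_algebra" "f ^ m \<in> I" "m \<le> n"
  shows "f ^ n \<in> I"
  using ideal_mult_left[OF assms(1,2), of "f ^ (n - m)"] assms(3)
  by (simp flip: power_add)

lemma UNIV_xyz: "(UNIV :: xyz set) = {Var_x, Var_y, Var_z}"
  using xyz.exhaust by auto

lemma mdegree_xyz:
  "mdegree m = Poly_Mapping.lookup m Var_x + Poly_Mapping.lookup m Var_y
     + Poly_Mapping.lookup m Var_z"
proof -
  have "mdegree m = (\<Sum>v\<in>UNIV. Poly_Mapping.lookup m v)"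
    unfolding mdegree_def
    by (rule sum.mono_neutral_left) (simp_all add: in_keys_iff, simp add: UNIV_xyz)
  then show ?thesis by (simp add: UNIV_xyz)
qed

definition exponent :: "nat \<Rightarrow> nat \<Rightarrow> nat \<Rightarrow> (xyz \<Rightarrow>\<^sub>0 nat)" where
  "exponent i j k = Poly_Mapping.single Var_x i + Poly_Mapping.single Var_y j
     + Poly_Mapping.single Var_z k"

lemma lookup_exponent [simp]:
  "Poly_Mapping.lookup (exponent i j k) Var_x = i"
  "Poly_Mapping.lookup (exponent i j k) Var_y = j"
  "Poly_Mapping.lookup (exponent i j k) Var_z = k"
  by (simp_all add: exponent_def lookup_add lookup_single)

lemma exponent_eqI:
  assumes "Poly_Mapping.lookup m Var_x = i" "Poly_Mapping.lookup m Var_y = j"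
    "Poly_Mapping.lookup m Var_z = k"
  shows "m = exponent i j k"
proof (rule poly_mapping_eqI)
  fix v show "Poly_Mapping.lookup m v = Poly_Mapping.lookup (exponent i j k) v"
    using assms by (cases v) simp_all
qed

lemma exponent_cases:
  obtains i j k where "m = exponent i j k"
  using exponent_eqI by blast

lemma exponent_inject [simp]:
  "exponent i j k = exponent i' j' k' \<longleftrightarrow> i = i' \<and> j = j' \<and> k = k'"
  by (metis lookup_exponent)

lemma mvar_power:
  "(mvar v :: ('v, 'k :: comm_ring_1) mpoly) ^ n = Poly_Mapping.single (Poly_Mapping.single v n) 1"
  by (induction n) (simp_all add: mvar_def mult_single flip: single_add)

lemma monomial_eq_product:
  "(Poly_Mapping.single (exponent i j k) a :: (xyz, 'k :: comm_ring_1) mpoly) =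
     Poly_Mapping.single 0 a * mvar Var_x ^ i * mvar Var_y ^ j * mvar Var_z ^ k"
  by (simp add: mvar_power mult_single exponent_def)

lemma mvar_in_forms: "mvar v \<in> forms 1"
  by (auto simp: mvar_def mdegree_def intro: single_in_forms)

lemma constant_in_forms: "Poly_Mapping.single 0 a \<in> forms 0"
  by (auto simp: mdegree_def intro: single_in_forms)

text \<open>The only exponents of degree one are those of the three variables.\<close>
lemma linear_form_cases:
  assumes "L \<in> forms 1"
  obtains \<alpha> \<beta> \<gamma> :: "'k :: comm_ring_1"
  where "L = Poly_Mapping.single 0 \<alpha> * mvar Var_x + Poly_Mapping.single 0 \<beta> * mvar Var_y
           + Poly_Mapping.single 0 \<gamma> * mvar Var_z"
proof
  let ?S = "{exponent 1 0 0, exponent 0 1 0, exponent 0 0 1}"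
  have "k \<in> ?S" if "mdegree k = 1" for k
  proof -
    obtain i j l where "k = exponent i j l"
      by (rule exponent_cases)
    with that show ?thesis
      by (auto simp: mdegree_xyz add_is_1)
  qed
  then have "Poly_Mapping.keys L \<subseteq> ?S"
    using assms by (auto simp: forms_def)
  then have "(\<Sum>k\<in>Poly_Mapping.keys L. Poly_Mapping.single k (Poly_Mapping.lookup L k))
      = (\<Sum>k\<in>?S. Poly_Mapping.single k (Poly_Mapping.lookup L k))"
    by (intro sum.mono_neutral_left) (auto simp: in_keys_iff)
  then have "L = (\<Sum>k\<in>?S. Poly_Mapping.single k (Poly_Mapping.lookup L k))"
    by (simp flip: poly_mapping_eq_sum_single)
  then show "L = Poly_Mapping.single 0 (Poly_Mapping.lookup L (exponent 1 0 0)) * mvar Var_x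
      + Poly_Mapping.single 0 (Poly_Mapping.lookup L (exponent 0 1 0)) * mvar Var_y
      + Poly_Mapping.single 0 (Poly_Mapping.lookup L (exponent 0 0 1)) * mvar Var_z"
    by (simp add: monomial_eq_product add.assoc)
qed

lemma ideal_monomial_ci_ideal:
  "ideal (monomial_ci_ideal l m n :: (xyz, 'k :: comm_ring_1) mpoly set) ring_of_type_algebra"
  unfolding monomial_ci_ideal_def
  by (rule ring.genideal_ideal) (auto simp: ring_of_type_algebra_simps ring_from_type_algebra)

lemma generators_in_monomial_ci_ideal:
  "(mvar Var_x ^ l :: (xyz, 'k :: comm_ring_1) mpoly) \<in> monomial_ci_ideal l m n"
  "(mvar Var_y ^ m :: (xyz, 'k) mpoly) \<in> monomial_ci_ideal l m n"
  "(mvar Var_z ^ n :: (xyz, 'k) mpoly) \<in> monomial_ci_ideal l m n"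
  unfolding monomial_ci_ideal_def
  using ring.genideal_self[OF ring_from_type_algebra,
      of "{mvar Var_x ^ l, mvar Var_y ^ m, mvar Var_z ^ n :: (xyz, 'k) mpoly}"]
  by (simp_all add: ring_of_type_algebra_simps)

text \<open>Membership in a monomial ideal can be tested on monomials. The right-hand side is an ideal
  that contains the three generators; conversely each of its monomials is a multiple of a
  generator.\<close>
lemma monomial_ci_ideal_eq:
  "(monomial_ci_ideal l m n :: (xyz, 'k :: comm_ring_1) mpoly set) =
     {f. \<forall>k\<in>Poly_Mapping.keys f. l \<le> Poly_Mapping.lookup k Var_x \<or>
        m \<le> Poly_Mapping.lookup k Var_y \<or> n \<le> Poly_Mapping.lookup k Var_z}" (is "?I = ?M")
proof
  note I = ideal_monomial_ci_ideal[of l m n, where 'k = 'k]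
  have "ideal ?M ring_of_type_algebra"
    unfolding ideal_ring_of_type_algebra_iff
  proof (intro conjI ballI allI)
    fix f g assume "f \<in> ?M" "g \<in> ?M"
    then show "f + g \<in> ?M" using keys_add[of f g] by blast
  next
    fix f g assume "g \<in> ?M"
    then show "f * g \<in> ?M"
      using keys_mult[of f g] by (fastforce simp: lookup_add)
  qed simp
  then show "?I \<subseteq> ?M"
    unfolding monomial_ci_ideal_def
    by (rule ring.genideal_minimal[OF ring_from_type_algebra])
      (simp add: mvar_power)
  show "?M \<subseteq> ?I"
  proof
    fix f :: "(xyz, 'k) mpoly" assume f: "f \<in> ?M"
    have "Poly_Mapping.single k a \<in> ?I" if "l \<le> Poly_Mapping.lookup k Var_x \<or>
        m \<le> Poly_Mapping.lookup k Var_y \<or> n \<le> Poly_Mapping.lookup k Var_z" for k a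
    proof -
      obtain r s t where k: "k = exponent r s t"
        by (rule exponent_cases)
      with that consider "l \<le> r" | "m \<le> s" | "n \<le> t" by auto
      then have "mvar Var_x ^ r \<in> ?I \<or> mvar Var_y ^ s \<in> ?I \<or> mvar Var_z ^ t \<in> ?I"
        by cases (use ideal_power_le[OF I] generators_in_monomial_ci_ideal in blast)+
      then show ?thesis
        unfolding k monomial_eq_product
        by (auto intro: ideal_mult_left[OF I] ideal_mult_right[OF I])
    qed
    with f have "(\<Sum>k\<in>Poly_Mapping.keys f. Poly_Mapping.single k (Poly_Mapping.lookup f k)) \<in> ?I"
      by (intro ideal_sum[OF I]) auto
    then show "f \<in> ?I" by (simp flip: poly_mapping_eq_sum_single)
  qed
qed

lemma monomial_in_monomial_ci_ideal_iff:
  "(Poly_Mapping.single (exponent i j k) a :: (xyz, 'k :: comm_ring_1) mpoly)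
      \<in> monomial_ci_ideal l m n \<longleftrightarrow> a = 0 \<or> l \<le> i \<or> m \<le> j \<or> n \<le> k"
  by (simp add: monomial_ci_ideal_eq)

section \<open>Duality\<close>

text \<open>Over a field the quotient is a Gorenstein algebra: its top degree is \<open>l + m + n - 3\<close>, spanned by
  \<open>x\<^sup>l\<^sup>-\<^sup>1 y\<^sup>m\<^sup>-\<^sup>1 z\<^sup>n\<^sup>-\<^sup>1\<close>, and the product pairs complementary degrees perfectly. For the monomial
  algebra this is elementary: if a monomial outside the ideal occurs in \<open>f\<close>, multiplication by the
  complementary monomial moves its coefficient to the socle monomial.\<close>
lemma socle_pairing_nondegenerate:
  fixes f :: "(xyz, 'k :: comm_ring_1) mpoly"
  assumes f: "f \<in> forms i" "f \<notin> monomial_ci_ideal l m n" and "i + j + 3 = l + m + n"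
  obtains g where "g \<in> forms j" "f * g \<notin> monomial_ci_ideal l m n"
proof -
  from f(2) obtain k where k: "k \<in> Poly_Mapping.keys f" "Poly_Mapping.lookup k Var_x < l"
    "Poly_Mapping.lookup k Var_y < m" "Poly_Mapping.lookup k Var_z < n"
    by (auto simp: monomial_ci_ideal_eq not_le)
  \<comment> \<open>The complementary exponent: \<open>k + q\<close> is that of the socle monomial.\<close>
  define q where "q = exponent (l - 1 - Poly_Mapping.lookup k Var_x)
    (m - 1 - Poly_Mapping.lookup k Var_y) (n - 1 - Poly_Mapping.lookup k Var_z)"
  have deg: "mdegree k = i" using k f by (auto simp: forms_def)
  have "mdegree q = j"
    using deg k assms(3) by (simp add: q_def mdegree_xyz)
  moreover have "Poly_Mapping.lookup (f * Poly_Mapping.single q 1) (k + q) \<noteq> 0"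
    using k(1) by (simp add: lookup_times_single in_keys_iff)
  then have "f * Poly_Mapping.single q 1 \<notin> monomial_ci_ideal l m n"
    using k by (auto simp: monomial_ci_ideal_eq in_keys_iff q_def lookup_add
        intro!: bexI[of _ "k + q"])
  ultimately show ?thesis
    using that single_in_forms by blast
qed

text \<open>Multiplication by \<open>L\<close> from degree \<open>i\<close> to \<open>i + 1\<close> is adjoint, under the socle pairing,
  to multiplication from the complementary degree \<open>j - 1\<close> to \<open>j\<close>. So a nonzero \<open>f\<close> with
  \<open>L f = 0\<close> pairs to zero with the image of \<open>L\<close> in degree \<open>j\<close>, and something in that degree is
  missed. The lemma serves both directions of the equivalence: it turns one kernel element in the
  middle degree into a failure of both injectivity and surjectivity, and it turns surjectivity
  above the middle into injectivity below, without any dimension count.\<close>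
lemma annihilated_form_obstructs_surjectivity:
  fixes f L :: "(xyz, 'k :: comm_ring_1) mpoly"
  assumes "f \<in> forms i" "f \<notin> monomial_ci_ideal l m n" "L * f \<in> monomial_ci_ideal l m n"
    and "i + j + 3 = l + m + n"
  shows "\<exists>g\<in>forms j. \<forall>h. g - L * h \<notin> monomial_ci_ideal l m n"
proof -
  note I = ideal_monomial_ci_ideal[of l m n, where 'k = 'k]
  obtain g where g: "g \<in> forms j" "f * g \<notin> monomial_ci_ideal l m n"
    using socle_pairing_nondegenerate[OF assms(1,2,4)] .
  have "g - L * h \<notin> monomial_ci_ideal l m n" for h
  proof
    assume "g - L * h \<in> monomial_ci_ideal l m n"
    then have "f * (g - L * h) + h * (L * f) \<in> monomial_ci_ideal l m n"
      by (rule ideal_add[OF I ideal_mult_left[OF I] ideal_mult_left[OF I assms(3)]])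
    moreover have "f * (g - L * h) + h * (L * f) = f * g"
      by (simp add: algebra_simps)
    ultimately show False using g(2) by simp
  qed
  with g(1) show ?thesis by blast
qed

section \<open>The binomial coefficient as an obstruction\<close>

text \<open>The total exponent \<open>b + c\<close> is the largest for which a monomial in \<open>x\<close> and \<open>y\<close> can survive
  modulo \<open>x\<^sup>b\<^sup>+\<^sup>1\<close> and \<open>y\<^sup>c\<^sup>+\<^sup>1\<close>, and only \<open>x\<^sup>b y\<^sup>c\<close> does. This is where the binomial coefficient
  enters.\<close>
lemma power_of_linear_form_in_x_y:
  fixes \<alpha> \<beta> :: "'k :: comm_ring_1"
  shows "(Poly_Mapping.single 0 \<alpha> * mvar Var_x + Poly_Mapping.single 0 \<beta> * mvar Var_y) ^ (b + c)
     - Poly_Mapping.single 0 (of_nat ((b + c) choose b) * \<alpha> ^ b * \<beta> ^ c)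
         * mvar Var_x ^ b * mvar Var_y ^ c
     \<in> monomial_ci_ideal (b + 1) (c + 1) n"
proof -
  let ?I = "monomial_ci_ideal (b + 1) (c + 1) n :: (xyz, 'k) mpoly set"
  note I = ideal_monomial_ci_ideal[of "b + 1" "c + 1" n, where 'k = 'k]
  define t where "t k = (of_nat ((b + c) choose k)
      * (Poly_Mapping.single 0 \<alpha> * mvar Var_x) ^ k
      * (Poly_Mapping.single 0 \<beta> * mvar Var_y) ^ (b + c - k) :: (xyz, 'k) mpoly)" for k
  have const_power: "(Poly_Mapping.single 0 a :: (xyz, 'k) mpoly) ^ k = Poly_Mapping.single 0 (a ^ k)"
    for a k by (induction k) (simp_all add: mult_single)
  have t_eq: "t k = Poly_Mapping.single (exponent k (b + c - k) 0)
      (of_nat ((b + c) choose k) * \<alpha> ^ k * \<beta> ^ (b + c - k))" for k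
    unfolding t_def monomial_eq_product single_of_nat[symmetric]
    by (simp add: power_mult_distrib const_power mult_single[of 0 _ 0, simplified, symmetric] mult_ac
        del: single_of_nat)
  have "(Poly_Mapping.single 0 \<alpha> * mvar Var_x + Poly_Mapping.single 0 \<beta> * mvar Var_y) ^ (b + c)
      = (\<Sum>k\<le>b + c. t k)"
    by (simp add: binomial_ring t_def)
  also have "\<dots> = t b + (\<Sum>k\<in>{..b + c} - {b}. t k)"
    by (rule sum.remove) auto
  finally have "(Poly_Mapping.single 0 \<alpha> * mvar Var_x + Poly_Mapping.single 0 \<beta> * mvar Var_y) ^ (b + c)
      - t b = (\<Sum>k\<in>{..b + c} - {b}. t k)" by simp
  also have "\<dots> \<in> ?I"
    by (intro ideal_sum[OF I]) (auto simp: t_eq monomial_in_monomial_ci_ideal_iff)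
  finally show ?thesis
    by (simp add: t_eq monomial_eq_product)
qed

text \<open>Write \<open>L = w - u\<close> with \<open>w = \<alpha> x + \<beta> y\<close> and \<open>u = - \<gamma> z\<close>. If the binomial
  coefficient vanishes, then both \<open>w\<close> and \<open>u\<close> have zero \<open>(b + c)\<close>-th power in the quotient, so
  \<open>L\<close> annihilates the geometric sum of the \<open>u\<^sup>i w\<^sup>j\<close> with \<open>i + j = b + c - 1\<close>. That sum is nonzero
  since multiplying it by \<open>x\<^sup>b y\<^sup>c\<close>, which kills \<open>w\<close>, leaves a nonzero multiple of the socle
  monomial.\<close>
lemma geometric_sum_annihilated:
  fixes \<alpha> \<beta> \<gamma> :: "'k :: field"
  assumes "b > 0" "of_nat ((b + c) choose b) = (0 :: 'k)" "\<gamma> \<noteq> 0"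
  defines "L \<equiv> Poly_Mapping.single 0 \<alpha> * mvar Var_x + Poly_Mapping.single 0 \<beta> * mvar Var_y
                + Poly_Mapping.single 0 \<gamma> * mvar Var_z"
  shows "\<exists>f\<in>forms (b + c - 1). f \<notin> monomial_ci_ideal (b + 1) (c + 1) (b + c) \<and>
    L * f \<in> monomial_ci_ideal (b + 1) (c + 1) (b + c)"
proof -
  let ?I = "monomial_ci_ideal (b + 1) (c + 1) (b + c) :: (xyz, 'k) mpoly set"
  note I = ideal_monomial_ci_ideal[of "b + 1" "c + 1" "b + c", where 'k = 'k]
  define w where "w = (Poly_Mapping.single 0 \<alpha> * mvar Var_x
    + Poly_Mapping.single 0 \<beta> * mvar Var_y :: (xyz, 'k) mpoly)"
  define u where "u = (Poly_Mapping.single 0 (- \<gamma>) * mvar Var_z :: (xyz, 'k) mpoly)"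
  define s where "s = (mvar Var_x ^ b * mvar Var_y ^ c :: (xyz, 'k) mpoly)"
  define f where "f = (\<Sum>i<b + c. u ^ (b + c - Suc i) * w ^ i)"
  have u_power: "u ^ k = Poly_Mapping.single (exponent 0 0 k) ((- \<gamma>) ^ k)" for k
    by (induction k) (simp_all add: u_def mvar_def mult_single exponent_def flip: single_add)
  have L: "L = w - u"
    by (simp add: L_def w_def u_def single_uminus)
  have "w \<in> forms 1" "u \<in> forms 1"
    using forms_mult[OF constant_in_forms mvar_in_forms]
    by (auto simp: w_def u_def simp del: One_nat_def intro!: forms_add)
  have "f \<in> forms (b + c - 1)"
    unfolding f_def
  proof (rule forms_sum)
    fix i assume "i \<in> {..<b + c}"
    then have "(b + c - Suc i) * 1 + i * 1 = b + c - 1" by simp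
    then show "u ^ (b + c - Suc i) * w ^ i \<in> forms (b + c - 1)"
      using forms_mult[OF forms_power[OF \<open>u \<in> forms 1\<close>] forms_power[OF \<open>w \<in> forms 1\<close>]] by metis
  qed
  moreover have "L * f \<in> ?I"
  proof -
    have "L * f = w ^ (b + c) - u ^ (b + c)"
      unfolding L f_def by (rule power_diff_sumr2[symmetric])
    moreover have "w ^ (b + c) \<in> ?I"
      using power_of_linear_form_in_x_y[of \<alpha> \<beta> b c "b + c"] assms(2) by (simp add: w_def)
    moreover have "u ^ (b + c) \<in> ?I"
      by (simp add: u_power monomial_in_monomial_ci_ideal_iff)
    ultimately show ?thesis by (simp only: ideal_diff[OF I])
  qed
  moreover have "f \<notin> ?I"
  proof
    assume "f \<in> ?I"
    have "w * s \<in> ?I"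
    proof -
      have "w * s = Poly_Mapping.single 0 \<alpha> * mvar Var_y ^ c * mvar Var_x ^ (b + 1)
          + Poly_Mapping.single 0 \<beta> * mvar Var_x ^ b * mvar Var_y ^ (c + 1)"
        by (simp add: w_def s_def algebra_simps)
      then show ?thesis
        by (simp only: ideal_add[OF I] ideal_mult_left[OF I] generators_in_monomial_ci_ideal)
    qed
    obtain d where d: "b + c = Suc d"
      using assms(1) by (metis Suc_pred add_gr_0)
    have "f = u ^ d + (\<Sum>i<d. u ^ (d - Suc i) * w ^ Suc i)"
      unfolding f_def d by (subst sum.lessThan_Suc_shift) simp
    then have "u ^ d * s = f * s - (\<Sum>i<d. u ^ (d - Suc i) * w ^ i * (w * s))"
      by (simp add: algebra_simps sum_distrib_left sum_distrib_right)
    also have "\<dots> \<in> ?I"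
      by (rule ideal_diff[OF I ideal_mult_right[OF I \<open>f \<in> ?I\<close>]
            ideal_sum[OF I ideal_mult_left[OF I \<open>w * s \<in> ?I\<close>]]])
    also have "u ^ d * s = Poly_Mapping.single (exponent b c d) ((- \<gamma>) ^ d)"
      by (simp add: u_power s_def mvar_power mult_single exponent_def add_ac)
    finally show False
      using \<open>\<gamma> \<noteq> 0\<close> d by (simp add: monomial_in_monomial_ci_ideal_iff)
  qed
  ultimately show ?thesis by blast
qed

lemma variable_times_monomial:
  "Poly_Mapping.single 0 \<alpha> * mvar Var_x * Poly_Mapping.single (exponent i j k) a =
     (Poly_Mapping.single (exponent (Suc i) j k) (\<alpha> * a) :: (xyz, 'k :: comm_ring_1) mpoly)"
  "Poly_Mapping.single 0 \<alpha> * mvar Var_y * Poly_Mapping.single (exponent i j k) a =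
     (Poly_Mapping.single (exponent i (Suc j) k) (\<alpha> * a) :: (xyz, 'k) mpoly)"
  by (auto simp: mvar_def mult_single lookup_add lookup_single
      intro!: arg_cong[of _ _ "\<lambda>m. Poly_Mapping.single m _"] exponent_eqI)

text \<open>Counting dimensions shows that a linear form without \<open>z\<close> has a kernel in degree
  \<open>b + c - 1\<close>: among the forms in \<open>x\<close> and \<open>y\<close> alone, it maps the plane spanned by
  \<open>x\<^sup>b\<^sup>-\<^sup>1 y\<^sup>c\<close> and \<open>x\<^sup>b y\<^sup>c\<^sup>-\<^sup>1\<close> into the line spanned by \<open>x\<^sup>b y\<^sup>c\<close>.\<close>
lemma binary_linear_form_annihilated:
  fixes \<alpha> \<beta> :: "'k :: field"
  assumes "b > 0" "c > 0"
  defines "L \<equiv> Poly_Mapping.single 0 \<alpha> * mvar Var_x + Poly_Mapping.single 0 \<beta> * mvar Var_y"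
  shows "\<exists>f\<in>forms (b + c - 1). f \<notin> monomial_ci_ideal (b + 1) (c + 1) (b + c) \<and>
    L * f \<in> monomial_ci_ideal (b + 1) (c + 1) (b + c)"
proof -
  let ?I = "monomial_ci_ideal (b + 1) (c + 1) (b + c) :: (xyz, 'k) mpoly set"
  note I = ideal_monomial_ci_ideal[of "b + 1" "c + 1" "b + c", where 'k = 'k]
  have m: "m \<in> forms (b + c - 1)"
    if "m = Poly_Mapping.single (exponent (b - 1) c 0) a \<or> m = Poly_Mapping.single (exponent b (c - 1) 0) a"
    for m :: "(xyz, 'k) mpoly" and a
    using assms(1,2) that by (auto intro!: single_in_forms simp: mdegree_xyz)
  show ?thesis
  proof (cases "\<alpha> = 0 \<and> \<beta> = 0")
    case True
    then have "L = 0" by (simp add: L_def)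
    then show ?thesis
      using assms(1) m
      by (intro bexI[of _ "Poly_Mapping.single (exponent (b - 1) c 0) 1"])
        (auto simp: monomial_in_monomial_ci_ideal_iff monomial_ci_ideal_eq)
  next
    case False
    define f where "f = (Poly_Mapping.single (exponent (b - 1) c 0) \<beta>
      - Poly_Mapping.single (exponent b (c - 1) 0) \<alpha> :: (xyz, 'k) mpoly)"
    have "f \<in> forms (b + c - 1)"
      unfolding f_def using m by (intro forms_diff) auto
    moreover have "f \<notin> ?I"
    proof
      assume "f \<in> ?I"
      then have "Poly_Mapping.lookup f (exponent (b - 1) c 0) = 0"
        "Poly_Mapping.lookup f (exponent b (c - 1) 0) = 0"
        using assms(1,2) by (force simp: monomial_ci_ideal_eq in_keys_iff)+
      then show False
        using False assms(1,2)
        by (simp add: f_def lookup_minus lookup_single when_def) (auto split: if_splits)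
    qed
    moreover have "L * f \<in> ?I"
    proof -
      have "L * f = Poly_Mapping.single (exponent (b - 1) (c + 1) 0) (\<beta> * \<beta>)
          - Poly_Mapping.single (exponent (b + 1) (c - 1) 0) (\<alpha> * \<alpha>)"
        using assms(1,2)
        by (simp add: L_def f_def distrib_right right_diff_distrib variable_times_monomial
            mult.commute[of \<beta> \<alpha>])
      also have "\<dots> \<in> ?I"
        by (rule ideal_diff[OF I]) (use assms(1,2) in \<open>auto simp: monomial_in_monomial_ci_ideal_iff\<close>)
      finally show ?thesis .
    qed
    ultimately show ?thesis by blast
  qed
qed

text \<open>In the quotient by \<open>x + y + z\<close> one can replace \<open>z\<close> by \<open>- (x + y)\<close>, so the degree
  \<open>d + 1 \<ge> b + c\<close> part is spanned by monomials in \<open>x\<close> and \<open>y\<close>, of which at most \<open>x\<^sup>b y\<^sup>c\<close> is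
  nonzero. But \<open>0 = z\<^sup>b\<^sup>+\<^sup>c\<close> becomes, up to sign, \<open>(x + y)\<^sup>b\<^sup>+\<^sup>c\<close>, which is the binomial coefficient
  times \<open>x\<^sup>b y\<^sup>c\<close>; if the coefficient is invertible, nothing is left.\<close>
lemma sum_of_variables_surjective:
  fixes g :: "(xyz, 'k :: field) mpoly"
  assumes "of_nat ((b + c) choose b) \<noteq> (0 :: 'k)" and "b + c \<le> d + 1" and "g \<in> forms (Suc d)"
  obtains f where "f \<in> forms d"
    "g - (mvar Var_x + mvar Var_y + mvar Var_z) * f \<in> monomial_ci_ideal (b + 1) (c + 1) (b + c)"
proof -
  let ?I = "monomial_ci_ideal (b + 1) (c + 1) (b + c) :: (xyz, 'k) mpoly set"
  note I = ideal_monomial_ci_ideal[of "b + 1" "c + 1" "b + c", where 'k = 'k]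
  define C where "C = (of_nat ((b + c) choose b) :: 'k)"
  define w where "w = (mvar Var_x + mvar Var_y :: (xyz, 'k) mpoly)"
  \<comment> \<open>A difference, so that the factorization of a difference of powers applies.\<close>
  define L where "L = w - (- mvar Var_z)"
  \<comment> \<open>The polynomials that vanish in the cokernel of \<open>L\<close>.\<close>
  define S where "S = {g. \<exists>f\<in>forms d. g - L * f \<in> ?I}"
  have S_I: "g \<in> S" if "g \<in> ?I" for g
    using that by (auto simp: S_def intro!: bexI[of _ 0] zero_in_forms)
  have S_L: "L * f \<in> S" if "f \<in> forms d" for f
    using that by (auto simp: S_def intro!: bexI[of _ f] simp: monomial_ci_ideal_eq)
  have S_diff: "g - h \<in> S" if "g \<in> S" "h \<in> S" for g h
  proof -
    from that obtain f f' where f: "f \<in> forms d" "f' \<in> forms d" "g - L * f \<in> ?I" "h - L * f' \<in> ?I"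
      by (auto simp: S_def)
    have "g - h - L * (f - f') = (g - L * f) - (h - L * f')"
      by (simp add: algebra_simps)
    with ideal_diff[OF I f(3,4)] have "g - h - L * (f - f') \<in> ?I"
      by (simp only:)
    then show ?thesis
      using f forms_diff by (auto simp: S_def)
  qed
  have S_sum: "sum h T \<in> S" if "\<And>k. k \<in> T \<Longrightarrow> h k \<in> S" for h and T :: "(xyz \<Rightarrow>\<^sub>0 nat) set"
  proof -
    have zero: "0 \<in> S" by (rule S_I[OF ideal_zero[OF I]])
    have "g + h \<in> S" if "g \<in> S" "h \<in> S" for g h
      using S_diff[OF that(1) S_diff[OF zero that(2)]] by simp
    with that zero show ?thesis
      by (induction T rule: infinite_finite_induct) auto
  qed
  have forms_1: "w \<in> forms 1" "- mvar Var_z \<in> forms 1"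
    by (auto simp: w_def intro!: forms_add forms_uminus mvar_in_forms simp del: One_nat_def)
  \<comment> \<open>The witness is the geometric sum with \<open>L q = (a / C) (w\<^sup>b\<^sup>+\<^sup>c - (- z)\<^sup>b\<^sup>+\<^sup>c)\<close>.\<close>
  have socle_xy: "Poly_Mapping.single (exponent b c 0) a \<in> S" if "b + c = d + 1" for a
  proof -
    define q where "q = Poly_Mapping.single 0 (a / C)
      * (\<Sum>i<b + c. (- mvar Var_z) ^ (b + c - Suc i) * w ^ i)"
    have "q \<in> forms (0 + d)"
      unfolding q_def
    proof (intro forms_mult constant_in_forms forms_sum)
      fix i assume "i \<in> {..<b + c}"
      then have "(b + c - Suc i) * 1 + i * 1 = d" using that by simp
      then show "(- mvar Var_z) ^ (b + c - Suc i) * w ^ i \<in> forms d"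
        using forms_mult[OF forms_power[OF forms_1(2)] forms_power[OF forms_1(1)]] by metis
    qed
    then have "L * q \<in> S" using S_L by simp
    have "L * q = Poly_Mapping.single 0 (a / C) * (w ^ (b + c) - (- mvar Var_z) ^ (b + c))"
      unfolding q_def L_def power_diff_sumr2 by (simp add: mult_ac)
    moreover have wI: "w ^ (b + c) - Poly_Mapping.single 0 C * mvar Var_x ^ b * mvar Var_y ^ c \<in> ?I"
      using power_of_linear_form_in_x_y[of "1 :: 'k" 1 b c "b + c"]
      by (simp add: w_def C_def)
    moreover have zI: "(- mvar Var_z) ^ (b + c) \<in> ?I"
      unfolding power_minus[of "mvar Var_z"]
      by (rule ideal_mult_left[OF I generators_in_monomial_ci_ideal(3)])
    ultimately have "L * q - Poly_Mapping.single 0 (a / C)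
        * (Poly_Mapping.single 0 C * mvar Var_x ^ b * mvar Var_y ^ c)
      = Poly_Mapping.single 0 (a / C)
        * (w ^ (b + c) - Poly_Mapping.single 0 C * mvar Var_x ^ b * mvar Var_y ^ c
           - (- mvar Var_z) ^ (b + c))"
      by (simp add: right_diff_distrib)
    also have "\<dots> \<in> ?I"
      by (intro ideal_mult_left[OF I] ideal_diff[OF I] wI zI)
    finally have "L * q - Poly_Mapping.single 0 (a / C)
        * (Poly_Mapping.single 0 C * mvar Var_x ^ b * mvar Var_y ^ c) \<in> ?I" .
    moreover have "Poly_Mapping.single 0 (a / C)
        * (Poly_Mapping.single 0 C * mvar Var_x ^ b * mvar Var_y ^ c)
        = Poly_Mapping.single (exponent b c 0) a"
      using assms(1) by (simp add: monomial_eq_product mult_single flip: mult.assoc C_def)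
    ultimately have "L * q - Poly_Mapping.single (exponent b c 0) a \<in> ?I"
      by (simp only:)
    from S_diff[OF \<open>L * q \<in> S\<close> S_I[OF this]] show ?thesis
      by simp
  qed
  \<comment> \<open>Each factor \<open>z\<close> is traded for \<open>L - x - y\<close> until none is left.\<close>
  have monomial: "Poly_Mapping.single (exponent i j k) a \<in> S" if "i + j + k = Suc d" for i j k a
    using that
  proof (induction k arbitrary: i j)
    case 0
    consider "b < i" | "c < j" | "i = b" "j = c" "b + c = d + 1"
      using 0 assms(2) by linarith
    then show ?case
      by cases (auto intro!: S_I socle_xy simp: monomial_in_monomial_ci_ideal_iff)
  next
    case (Suc k)
    have "Poly_Mapping.single (exponent i j k) a \<in> forms d"
      using Suc.prems by (intro single_in_forms) (simp add: mdegree_xyz)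
    then have "L * Poly_Mapping.single (exponent i j k) a
        - Poly_Mapping.single (exponent (Suc i) j k) a
        - Poly_Mapping.single (exponent i (Suc j) k) a \<in> S"
      using Suc by (intro S_diff S_L) auto
    also have "L * Poly_Mapping.single (exponent i j k) a
        - Poly_Mapping.single (exponent (Suc i) j k) a
        - Poly_Mapping.single (exponent i (Suc j) k) a = Poly_Mapping.single (exponent i j (Suc k)) a"
      by (simp add: L_def w_def monomial_eq_product algebra_simps)
    finally show ?case .
  qed
  have "(\<Sum>k\<in>Poly_Mapping.keys g. Poly_Mapping.single k (Poly_Mapping.lookup g k)) \<in> S"
  proof (rule S_sum)
    fix k assume "k \<in> Poly_Mapping.keys g"
    with assms(3) have "mdegree k = Suc d" by (auto simp: forms_def)
    then show "Poly_Mapping.single k (Poly_Mapping.lookup g k) \<in> S"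
      by (cases k rule: exponent_cases) (auto simp: mdegree_xyz intro: monomial)
  qed
  then have "g \<in> S" by (simp flip: poly_mapping_eq_sum_single)
  then show ?thesis
    using that by (auto simp: S_def L_def w_def)
qed

section \<open>The Weak Lefschetz Property and the binomial coefficient\<close>

text \<open>The socle degree \<open>2 (b + c) - 1\<close> is odd, so the map from degree \<open>b + c - 1\<close> to
  \<open>b + c\<close> is self-adjoint under the socle pairing: it is injective exactly if it is surjective,
  and the binomial coefficient decides which of the two alternatives occurs.\<close>
lemma weak_lefschetz_monomial_ci_iff:
  assumes "b > 0" and "c > 0"
  shows "weak_lefschetz (monomial_ci TYPE('k :: field) (b + 1) (c + 1) (b + c))
      (monomial_ci_grading TYPE('k) (b + 1) (c + 1) (b + c)) \<longleftrightarrow>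
    of_nat ((b + c) choose b) \<noteq> (0 :: 'k)"
proof -
  let ?I = "monomial_ci_ideal (b + 1) (c + 1) (b + c) :: (xyz, 'k) mpoly set"
  have wlp: "weak_lefschetz (monomial_ci TYPE('k) (b + 1) (c + 1) (b + c))
      (monomial_ci_grading TYPE('k) (b + 1) (c + 1) (b + c)) \<longleftrightarrow>
    (\<exists>L\<in>forms 1. \<forall>i. (\<forall>f\<in>forms i. L * f \<in> ?I \<longrightarrow> f \<in> ?I) \<or>
                      (\<forall>g\<in>forms (Suc i). \<exists>f\<in>forms i. g - L * f \<in> ?I))"
    unfolding monomial_ci_def monomial_ci_grading_def
    by (rule weak_lefschetz_quotient_iff[OF ideal_monomial_ci_ideal])
  show ?thesis
  proof
    assume "of_nat ((b + c) choose b) \<noteq> (0 :: 'k)"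
    note surj = sum_of_variables_surjective[OF this]
    let ?L = "mvar Var_x + mvar Var_y + mvar Var_z :: (xyz, 'k) mpoly"
    have "(\<forall>f\<in>forms i. ?L * f \<in> ?I \<longrightarrow> f \<in> ?I) \<or>
          (\<forall>g\<in>forms (Suc i). \<exists>f\<in>forms i. g - ?L * f \<in> ?I)" for i
    proof (cases "b + c \<le> i + 1")
      case True
      then show ?thesis using surj by metis
    next
      case False
      have "f \<in> ?I" if f: "f \<in> forms i" "?L * f \<in> ?I" for f
      proof (rule ccontr)
        assume "f \<notin> ?I"
        \<comment> \<open>The degrees \<open>i\<close> and \<open>j + 1\<close> add up to the socle degree.\<close>
        define j where "j = 2 * (b + c) - 2 - i"
        have j: "i + Suc j + 3 = b + 1 + (c + 1) + (b + c)" "b + c \<le> j + 1"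
          using False by (auto simp: j_def)
        from annihilated_form_obstructs_surjectivity[OF f(1) \<open>f \<notin> ?I\<close> f(2) j(1)]
        show False using surj[OF j(2)] by metis
      qed
      then show ?thesis by blast
    qed
    moreover have "?L \<in> forms 1"
      by (intro forms_add mvar_in_forms)
    ultimately show "weak_lefschetz (monomial_ci TYPE('k) (b + 1) (c + 1) (b + c))
      (monomial_ci_grading TYPE('k) (b + 1) (c + 1) (b + c))"
      unfolding wlp by blast
  next
    assume "weak_lefschetz (monomial_ci TYPE('k) (b + 1) (c + 1) (b + c))
      (monomial_ci_grading TYPE('k) (b + 1) (c + 1) (b + c))"
    then obtain L where L: "L \<in> forms 1"
      and max_rank: "\<And>i. (\<forall>f\<in>forms i. L * f \<in> ?I \<longrightarrow> f \<in> ?I) \<or>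
                      (\<forall>g\<in>forms (Suc i). \<exists>f\<in>forms i. g - L * f \<in> ?I)"
      unfolding wlp by blast
    show "of_nat ((b + c) choose b) \<noteq> (0 :: 'k)"
    proof
      assume zero: "of_nat ((b + c) choose b) = (0 :: 'k)"
      obtain \<alpha> \<beta> \<gamma> where L_eq: "L = Poly_Mapping.single 0 \<alpha> * mvar Var_x
          + Poly_Mapping.single 0 \<beta> * mvar Var_y + Poly_Mapping.single 0 \<gamma> * mvar Var_z"
        using linear_form_cases[OF L] .
      have "\<exists>f\<in>forms (b + c - 1). f \<notin> ?I \<and> L * f \<in> ?I"
        using binary_linear_form_annihilated[OF assms, of \<alpha> \<beta>]
          geometric_sum_annihilated[OF assms(1) zero, of \<gamma> \<alpha> \<beta>]
        unfolding L_eq by (cases "\<gamma> = 0") simp_all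
      then obtain f where f: "f \<in> forms (b + c - 1)" "f \<notin> ?I" "L * f \<in> ?I"
        by blast
      have deg: "b + c - 1 + Suc (b + c - 1) + 3 = b + 1 + (c + 1) + (b + c)"
        using assms by simp
      from annihilated_form_obstructs_surjectivity[OF f deg] f max_rank[of "b + c - 1"]
      show False by blast
    qed
  qed
qed

theorem corollary4p3:
  fixes b c p :: nat
  assumes "b > 0" and "c > 0"
    and "prime p"
    and "infinite (UNIV :: 'k :: field set)"
    and "CHAR('k) = p"
  shows "card (partitions_in_rectangle b c) = (b + c) choose b \<and>
    (p dvd card (partitions_in_rectangle b c) \<longleftrightarrow>
      \<not> weak_lefschetz (monomial_ci TYPE('k) (b + 1) (c + 1) (b + c))
                       (monomial_ci_grading TYPE('k) (b + 1) (c + 1) (b + c)))"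
  using card_partitions_in_rectangle[of b c] assms(5)
  by (simp add: weak_lefschetz_monomial_ci_iff[OF assms(1,2), simplified] of_nat_eq_0_iff_char_dvd)

end
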